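(* Let $N\ge1$, let $\sigma:\{1,\dots,N\}\to\{1,\dots,N\}$ be a bijection, and let $f,g:\mathbb{T}\to\mathbb{R}$ be time series such that $\hat g(L)=\hat f(\sigma(L))$ for all $L\in\{1,\dots,N\}$. Then $\mathsf{bcd}_n^{\mathcal R}(\Psi_f)=\mathsf{bcd}_n^{\mathcal R}(\Psi_g)$ for every integer $n\ge 0$.
   Context: For a metric space $(X,d)$ and $\epsilon\in\mathbb{R}$, the Vietoris–Rips complex $\mathcal R_\epsilon(X)$ is the simplicial complex whose simplices are the nonempty finite subsets $\{x_0,\dots,x_n\}\subset X$ with $\max_{i,j}d(x_i,x_j)<\epsilon$. $\mathsf{bcd}_n^{\mathcal R}(X)$ denotes the $n$-dimensional barcode of the filtration $\{\mathcal R_\epsilon(X)\}_{\epsilon\in\mathbb{R}}$: the multiset of intervals (bars) $(b,d]$ (or $(b,\infty)$) of the persistence module $\{H_n(\mathcal R_\epsilon(X))\}_\epsilon$ (homology over a fixed field). For infinite totally bounded $X$ the barcode is that of the q-tame module (its persistence diagram, each off-diagonal point $(b,d)$ recorded as the bar $(b,d]$). $\mathbb{T}=\mathbb{R}/2\pi\mathbb{Z}$; $\hat f(L)=\frac1{2\pi}\int_0^{2\pi}f(t)e^{-iLt}\,dt$; $r_L^f=2|\hat f(L)|$. The $N$-truncated Liouville torus $\Psi_f$ is the Liouville torus in phase space $\mathbb{R}^{2N}$ of $H(\mathbf q,\mathbf p)=\sum_{L=1}^N\frac L2(p_L^2+q_L^2)$ on which $\frac{p_L^2+q_L^2}{2}=\frac{(r_L^f)^2}{2}$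 for each $L$; i.e. $\Psi_f=\{(\mathbf q,\mathbf p): q_L^2+p_L^2=(r_L^f)^2,\ L=1,\dots,N\}$. It carries the maximum metric: the maximum over $L$ of the Euclidean distances between the components in the $(q_L,p_L)$-planes. *)

theory Defs
  imports
    "HOL-Analysis.Analysis"
    "HOL-Combinatorics.Permutations"
    "HOL-Algebra.QuotRing"
    "Jordan_Normal_Form.VS_Connect"
begin

section \<open>Vietoris--Rips complexes\<close>

definition vietoris_rips :: "'a set \<Rightarrow> ('a \<Rightarrow> 'a \<Rightarrow> real) \<Rightarrow> real \<Rightarrow> 'a set set" where
  "vietoris_rips X d \<epsilon> =
     {S. finite S \<and> S \<noteq> {} \<and> S \<subseteq> X \<and> Max ((\<lambda>(x, y). d x y) ` (S \<times> S)) < \<epsilon>}"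


section \<open>Simplicial homology with coefficients in a field\<close>

text \<open>
  An oriented \<open>n\<close>-chain of a simplicial complex \<open>K\<close> (a set of finite nonempty sets) is a finitely
  supported alternating function on the orderings \<open>[v\<^sub>0, \<dots>, v\<^sub>n]\<close> of the \<open>n\<close>-simplices of \<open>K\<close>,
  extended by zero to all other lists.
\<close>

definition oriented_chains :: "'a set set \<Rightarrow> nat \<Rightarrow> ('a list \<Rightarrow> 'k::field) set" where
  "oriented_chains K n = {c. finite {xs. c xs \<noteq> 0} \<and>
     (\<forall>xs. c xs \<noteq> 0 \<longrightarrow> length xs = Suc n \<and> distinct xs \<and> set xs \<in> K) \<and>
     (\<forall>xs \<pi>. \<pi> permutes {..<length xs} \<longrightarrow> c (permute_list \<pi> xs) = of_int (sign \<pi>) * c xs)}"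

text \<open>
  The face of \<open>[v\<^sub>0, \<dots>, v\<^sub>n]\<close> opposite to \<open>v\<^sub>i\<close> occurs in the boundary with the sign \<open>(-1)\<^sup>i\<close>, which
  is the value of the alternating function \<open>[v\<^sub>0, \<dots>, v\<^sub>n]\<close> at \<open>v\<^sub>i\<close> followed by that face. Hence
  the formula below is the usual boundary operator; see \<open>boundary_oriented_simplex\<close>.
\<close>

definition boundary :: "nat \<Rightarrow> ('a list \<Rightarrow> 'k::field) \<Rightarrow> 'a list \<Rightarrow> 'k" where
  "boundary n c = (\<lambda>ys. if n = 0 then 0 else \<Sum>v | c (v # ys) \<noteq> 0. c (v # ys))"

definition oriented_simplex :: "'a list \<Rightarrow> 'a list \<Rightarrow> 'k::field" where
  "oriented_simplex xs =
     (\<lambda>ys. \<Sum>\<pi> | \<pi> permutes {..<length xs} \<and> permute_list \<pi> xs = ys. of_int (sign \<pi>))"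

lemma oriented_simplex_permute_list:
  assumes "distinct xs" "\<pi> permutes {..<length xs}"
  shows "(oriented_simplex xs (permute_list \<pi> xs) :: 'k::field) = of_int (sign \<pi>)"
proof -
  have "\<rho> = \<pi>" if \<rho>: "\<rho> permutes {..<length xs}" "permute_list \<rho> xs = permute_list \<pi> xs" for \<rho>
  proof
    fix i
    show "\<rho> i = \<pi> i"
    proof (cases "i < length xs")
      case True
      then have "xs ! \<rho> i = xs ! \<pi> i"
        using \<rho> assms(2) by (metis permute_list_nth)
      moreover have "\<rho> i < length xs" "\<pi> i < length xs"
        using True \<rho>(1) assms(2) by (auto dest: permutes_in_image)
      ultimately show ?thesis
        using assms(1) by (simp add: nth_eq_iff_index_eq)
    next
      case False
      then show ?thesis
        using \<rho>(1) assms(2) by (metis lessThan_iff permutes_not_in)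
    qed
  qed
  then have "{\<rho>. \<rho> permutes {..<length xs} \<and> permute_list \<rho> xs = permute_list \<pi> xs} = {\<pi>}"
    using assms(2) by auto
  then show ?thesis
    by (simp add: oriented_simplex_def)
qed

lemma oriented_simplex_nonzeroD:
  assumes "oriented_simplex xs ys \<noteq> (0::'k::field)"
  obtains \<pi> where "\<pi> permutes {..<length xs}" "ys = permute_list \<pi> xs"
proof (cases "{\<pi>. \<pi> permutes {..<length xs} \<and> permute_list \<pi> xs = ys} = {}")
  case True
  then show thesis
    using assms unfolding oriented_simplex_def by (metis sum.empty)
next
  case False
  then show thesis
    using that by auto
qed

lemma oriented_simplex_alternating:
  assumes xs: "distinct xs" and \<pi>: "\<pi> permutes {..<length ys}"
  shows "(oriented_simplex xs (permute_list \<pi> ys) :: 'k::field) =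
    of_int (sign \<pi>) * oriented_simplex xs ys"
proof (cases "mset ys = mset xs")
  case True
  then obtain \<rho> where \<rho>: "\<rho> permutes {..<length xs}" "permute_list \<rho> xs = ys"
    by (metis mset_eq_permutation)
  have len: "length ys = length xs"
    using True by (metis size_mset)
  have eq: "permute_list \<pi> ys = permute_list (\<rho> \<circ> \<pi>) xs"
    using \<pi> \<rho> len by (simp add: permute_list_compose)
  have "permutation \<pi>" "permutation \<rho>"
    using \<pi> \<rho>(1) by (auto simp: permutation_permutes)
  moreover have "\<rho> \<circ> \<pi> permutes {..<length xs}"
    using \<pi> \<rho> len by (simp add: permutes_compose)
  ultimately show ?thesis
    using eq \<rho> xs
    by (metis mult.commute of_int_mult oriented_simplex_permute_list sign_compose)
next
  case False
  then have "oriented_simplex xs ys = (0::'k)"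
    by (metis mset_permute_list oriented_simplex_nonzeroD)
  moreover have "mset (permute_list \<pi> ys) \<noteq> mset xs"
    using False \<pi> by simp
  then have "oriented_simplex xs (permute_list \<pi> ys) = (0::'k)"
    by (metis mset_permute_list oriented_simplex_nonzeroD)
  ultimately show ?thesis
    by simp
qed

lemma oriented_simplex_move_to_front:
  assumes "distinct xs"
  shows "(oriented_simplex xs (x # us @ vs) :: 'k::field) =
    (-1) ^ length us * oriented_simplex xs (us @ x # vs)"
proof (induction us arbitrary: vs rule: rev_induct)
  case Nil
  then show ?case by simp
next
  case (snoc u us)
  let ?t = "Transposition.transpose (length us) (Suc (length us))"
  let ?ys = "us @ u # x # vs"
  have t: "?t permutes {..<length ?ys}"
    by (rule permutes_swap_id) auto
  have "permute_list ?t ?ys = us @ x # u # vs"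
  proof (rule nth_equalityI)
    fix i
    assume i: "i < length (permute_list ?t ?ys)"
    consider "i < length us" | "i = length us" | "i = Suc (length us)"
      | "Suc (Suc (length us)) \<le> i"
      by linarith
    then show "permute_list ?t ?ys ! i = (us @ x # u # vs) ! i"
      using permute_list_nth[OF t, of i] i
      by cases (auto simp: transpose_apply_other nth_append nth_Cons split: nat.splits)
  qed auto
  then have "(oriented_simplex xs (us @ x # u # vs) :: 'k) = - oriented_simplex xs ?ys"
    using oriented_simplex_alternating[OF assms t, where 'k = 'k] by (simp add: sign_swap_id)
  then show ?case
    using snoc.IH[of "u # vs"] by simp
qed

lemma oriented_simplex_Cons_alternating:
  assumes xs: "distinct xs" and "\<pi> permutes {..<length ys}"
  shows "(oriented_simplex xs (v # permute_list \<pi> ys) :: 'k::field) =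
    of_int (sign \<pi>) * oriented_simplex xs (v # ys)"
proof -
  let ?A = "{..<length ys}"
  let ?\<pi> = "map_permutation ?A Suc \<pi>"
  have perm: "?\<pi> permutes {..<length (v # ys)}"
  proof (rule permutes_subset)
    show "?\<pi> permutes Suc ` ?A"
      using assms(2) by (intro map_permutation_permutes) (auto simp: bij_betw_def)
  qed auto
  have "v # permute_list \<pi> ys = permute_list ?\<pi> (v # ys)"
  proof (rule nth_equalityI)
    fix i
    assume i: "i < length (v # permute_list \<pi> ys)"
    show "(v # permute_list \<pi> ys) ! i = permute_list ?\<pi> (v # ys) ! i"
    proof (cases i)
      case 0
      then have "?\<pi> i = 0"
        by (auto simp: map_permutation_def restrict_id_def)
      then show ?thesis
        using 0 permute_list_nth[OF perm, of i] i by simp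
    next
      case (Suc j)
      then have "?\<pi> i = Suc (\<pi> j)"
        using i map_permutation_apply[of Suc ?A j \<pi>] by simp
      then show ?thesis
        using Suc permute_list_nth[OF perm, of i] permute_list_nth[OF assms(2), of j] i by simp
    qed
  qed simp
  moreover have "sign ?\<pi> = sign \<pi>"
    using assms(2) by (intro sign_map_permutation) auto
  ultimately show ?thesis
    using oriented_simplex_alternating[OF xs perm, where 'k = 'k] by simp
qed

lemma boundary_oriented_simplex:
  assumes "distinct xs" "length xs = Suc n" "n > 0"
  shows "boundary n (oriented_simplex xs) =
    (\<lambda>ys. \<Sum>i<length xs. (-1) ^ i * (oriented_simplex (take i xs @ drop (Suc i) xs) ys :: 'k::field))"
proof
  fix ys
  let ?F = "oriented_simplex xs :: 'a list \<Rightarrow> 'k"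
  have face: "?F (xs ! i # ys) = (-1) ^ i * oriented_simplex (take i xs @ drop (Suc i) xs) ys"
    if i: "i < length xs" for i
  proof -
    let ?zs = "take i xs @ drop (Suc i) xs"
    have split: "xs = take i xs @ xs ! i # drop (Suc i) xs"
      using i by (simp add: id_take_nth_drop)
    have mset: "mset xs = mset (xs ! i # ?zs)"
      by (subst split) simp
    have zs: "distinct ?zs"
      using assms(1) mset by (metis distinct.simps(2) mset_eq_imp_distinct_iff)
    show ?thesis
    proof (cases "mset ys = mset ?zs")
      case True
      then obtain \<rho> where \<rho>: "\<rho> permutes {..<length ?zs}" "permute_list \<rho> ?zs = ys"
        by (metis mset_eq_permutation)
      have "?F xs = 1"
        using oriented_simplex_permute_list[OF assms(1) permutes_id, where 'k = 'k] by simp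
      then have "?F (xs ! i # ?zs) = (-1) ^ i"
        using oriented_simplex_move_to_front[OF assms(1), of "xs ! i" "take i xs" "drop (Suc i) xs",
            where 'k = 'k] i split by simp
      then have "?F (xs ! i # ys) = of_int (sign \<rho>) * (-1) ^ i"
        using oriented_simplex_Cons_alternating[OF assms(1) \<rho>(1), of "xs ! i", where 'k = 'k] \<rho>(2)
        by simp
      moreover have "oriented_simplex ?zs ys = (of_int (sign \<rho>) :: 'k)"
        using oriented_simplex_permute_list[OF zs \<rho>(1), where 'k = 'k] \<rho>(2) by simp
      ultimately show ?thesis
        by (simp add: mult.commute)
    next
      case False
      then have "oriented_simplex ?zs ys = (0::'k)"
        by (metis mset_permute_list oriented_simplex_nonzeroD)
      moreover have "mset (xs ! i # ys) \<noteq> mset xs"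
        using False mset by simp
      then have "?F (xs ! i # ys) = 0"
        by (metis mset_permute_list oriented_simplex_nonzeroD)
      ultimately show ?thesis
        by simp
    qed
  qed
  have "v \<in> set xs" if "?F (v # ys) \<noteq> 0" for v
    using that
  proof (rule oriented_simplex_nonzeroD)
    fix \<pi>
    assume "\<pi> permutes {..<length xs}" "v # ys = permute_list \<pi> xs"
    then show ?thesis
      by (metis list.set_intros(1) set_permute_list)
  qed
  then have "(\<Sum>v | ?F (v # ys) \<noteq> 0. ?F (v # ys)) = (\<Sum>v\<in>set xs. ?F (v # ys))"
    by (intro sum.mono_neutral_left) auto
  also have "\<dots> = (\<Sum>i<length xs. ?F (xs ! i # ys))"
    using assms(1) by (intro sum.reindex_bij_betw[symmetric] bij_betw_nth) auto
  finally show "boundary n ?F ys =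
      (\<Sum>i<length xs. (-1) ^ i * oriented_simplex (take i xs @ drop (Suc i) xs) ys)"
    using assms(3) face by (simp add: boundary_def)
qed

definition chain_space :: "'a set set \<Rightarrow> nat \<Rightarrow> ('k::field, 'a list \<Rightarrow> 'k) module" where
  "chain_space K n = \<lparr>carrier = oriented_chains K n, mult = undefined, one = undefined,
     zero = (\<lambda>_. 0), add = (\<lambda>c c' xs. c xs + c' xs), smult = (\<lambda>a c xs. a * c xs)\<rparr>"

definition cycle_space :: "'a set set \<Rightarrow> nat \<Rightarrow> ('k::field, 'a list \<Rightarrow> 'k) module" where
  "cycle_space K n = (chain_space K n)\<lparr>carrier := {c \<in> oriented_chains K n. boundary n c = (\<lambda>_. 0)}\<rparr>"

definition boundaries :: "'a set set \<Rightarrow> nat \<Rightarrow> ('a list \<Rightarrow> 'k::field) set" where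
  "boundaries K n = boundary (Suc n) ` oriented_chains K (Suc n)"

text \<open>The operations on cosets follow \<^const>\<open>FactRing\<close>.\<close>

definition quotient_space :: "('k, 'v) module \<Rightarrow> 'v set \<Rightarrow> ('k, 'v set) module" where
  "quotient_space V B = \<lparr>carrier = a_rcosets\<^bsub>V\<^esub> B, mult = undefined, one = undefined,
     zero = B, add = set_add V, smult = (\<lambda>a A. \<Union>x\<in>A. B +>\<^bsub>V\<^esub> (a \<odot>\<^bsub>V\<^esub> x))\<rparr>"

definition homology :: "'a set set \<Rightarrow> nat \<Rightarrow> ('k::field, ('a list \<Rightarrow> 'k) set) module" where
  "homology K n = quotient_space (cycle_space K n) (boundaries K n)"

text \<open>The map \<open>H\<^sub>n(K) \<rightarrow> H\<^sub>n(L)\<close> induced by an inclusion \<open>K \<subseteq> L\<close> sends \<open>z + B\<^sub>n(K)\<close> to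
  \<open>z + B\<^sub>n(L)\<close>; it does not mention \<open>K\<close> explicitly.\<close>

definition homology_inclusion ::
  "'a set set \<Rightarrow> nat \<Rightarrow> ('a list \<Rightarrow> 'k::field) set \<Rightarrow> ('a list \<Rightarrow> 'k) set" where
  "homology_inclusion L n A = (\<Union>z\<in>A. boundaries L n +>\<^bsub>cycle_space L n\<^esub> z)"


section \<open>Barcodes of q-tame persistence modules\<close>

text \<open>
  A persistence module over \<open>\<real>\<close> is given by spaces \<open>V t\<close> and transition maps
  \<open>\<phi> s t : V s \<rightarrow> V t\<close> for \<open>s \<le> t\<close>. It is q-tame if \<open>\<phi> s t\<close> has finite rank whenever \<open>s < t\<close>;
  only then are the following notions meaningful, since \<open>vectorspace.dim\<close> is a natural number.
  The module is extended by \<open>V (-\<infinity>) = V \<infinity> = 0\<close>.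
\<close>

definition persistent_rank ::
  "(real \<Rightarrow> ('k::field, 'v) module) \<Rightarrow> (real \<Rightarrow> real \<Rightarrow> 'v \<Rightarrow> 'v) \<Rightarrow> ereal \<Rightarrow> ereal \<Rightarrow> nat" where
  "persistent_rank V \<phi> s t = (if s = -\<infinity> \<or> t = \<infinity> then 0 else
     let s' = real_of_ereal s; t' = real_of_ereal t
     in vectorspace.dim class_ring ((V t')\<lparr>carrier := \<phi> s' t' ` carrier (V s')\<rparr>))"

text \<open>The persistence measure of the rectangle \<open>[a, b] \<times> [c, d]\<close>, where
  \<open>-\<infinity> \<le> a < b < c < d \<le> \<infinity>\<close>: the number of bars born between \<open>a\<close> and \<open>b\<close> that die between
  \<open>c\<close> and \<open>d\<close>.\<close>

definition persistence_measure ::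
  "(real \<Rightarrow> ('k::field, 'v) module) \<Rightarrow> (real \<Rightarrow> real \<Rightarrow> 'v \<Rightarrow> 'v) \<Rightarrow>
   ereal \<Rightarrow> ereal \<Rightarrow> ereal \<Rightarrow> ereal \<Rightarrow> int" where
  "persistence_measure V \<phi> a b c d =
     int (persistent_rank V \<phi> b c) - int (persistent_rank V \<phi> a c)
     - int (persistent_rank V \<phi> b d) + int (persistent_rank V \<phi> a d)"

text \<open>
  The barcode is the (undecorated) persistence diagram. As it may be infinite, it is encoded by its
  multiplicity function: \<open>barcode V \<phi> p q\<close> is the multiplicity of the bar \<open>(p, q]\<close>, or of
  \<open>(p, \<infinity>)\<close> if \<open>q = \<infinity>\<close>. It is the least measure of a rectangle that has \<open>(p, q)\<close> in its
  interior relative to the extended plane, so that for instance \<open>[a, b] \<times> [c, \<infinity>]\<close> is a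
  neighbourhood of \<open>(p, \<infinity>)\<close> if \<open>a < p < b\<close>. The measure of rectangles is nonnegative for q-tame
  modules, hence nothing is truncated by \<^const>\<open>nat\<close>.
\<close>

definition barcode ::
  "(real \<Rightarrow> ('k::field, 'v) module) \<Rightarrow> (real \<Rightarrow> real \<Rightarrow> 'v \<Rightarrow> 'v) \<Rightarrow> ereal \<Rightarrow> ereal \<Rightarrow> nat" where
  "barcode V \<phi> p q = (if p < q then
     Inf {nat (persistence_measure V \<phi> a b c d) | a b c d.
            a < b \<and> b < c \<and> c < d \<and> (p, q) \<in> interior ({a..b} \<times> {c..d})}
     else 0)"

definition rips_barcode ::
  "'k::field itself \<Rightarrow> nat \<Rightarrow> 'a set \<Rightarrow> ('a \<Rightarrow> 'a \<Rightarrow> real) \<Rightarrow> ereal \<Rightarrow> ereal \<Rightarrow> nat" where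
  "rips_barcode _ n X d =
     barcode (\<lambda>\<epsilon>. homology (vietoris_rips X d \<epsilon>) n :: ('k, ('a list \<Rightarrow> 'k) set) module)
             (\<lambda>s t. homology_inclusion (vietoris_rips X d t) n)"


section \<open>Truncated Liouville tori of time series\<close>

text \<open>Functions on \<open>\<real>/2\<pi>\<int>\<close> are \<open>2\<pi>\<close>-periodic functions on \<open>\<real>\<close>. Integrability is what is needed
  for the Fourier coefficients to be defined.\<close>

definition time_series :: "(real \<Rightarrow> real) \<Rightarrow> bool" where
  "time_series f \<longleftrightarrow> (\<forall>t. f (t + 2 * pi) = f t) \<and> f absolutely_integrable_on {0..2 * pi}"

definition fourier_coeff :: "(real \<Rightarrow> real) \<Rightarrow> int \<Rightarrow> complex" where
  "fourier_coeff f L =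
     1 / (2 * pi) * integral {0..2 * pi} (\<lambda>t. of_real (f t) * exp (- \<i> * of_int L * of_real t))"

definition fourier_radius :: "(real \<Rightarrow> real) \<Rightarrow> nat \<Rightarrow> real" where
  "fourier_radius f L = 2 * cmod (fourier_coeff f (int L))"

type_synonym phase_point = "(nat \<Rightarrow> real) \<times> (nat \<Rightarrow> real)"

definition phase_space :: "nat \<Rightarrow> phase_point set" where
  "phase_space N = ({1..N} \<rightarrow>\<^sub>E UNIV) \<times> ({1..N} \<rightarrow>\<^sub>E UNIV)"

definition action :: "nat \<Rightarrow> phase_point \<Rightarrow> real" where
  "action L = (\<lambda>(q, p). ((p L)\<^sup>2 + (q L)\<^sup>2) / 2)"

text \<open>A common level set of the first integrals \<open>action 1, \<dots>, action N\<close> of the Hamiltonian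
  \<open>H = (\<Sum>L = 1..N. L * action L)\<close>.\<close>

definition liouville_torus :: "nat \<Rightarrow> (real \<Rightarrow> real) \<Rightarrow> phase_point set" where
  "liouville_torus N f =
     {x \<in> phase_space N. \<forall>L\<in>{1..N}. action L x = (fourier_radius f L)\<^sup>2 / 2}"

text \<open>\<^const>\<open>dist\<close> on \<open>\<real> \<times> \<real>\<close> is the Euclidean distance.\<close>

definition phase_dist :: "nat \<Rightarrow> phase_point \<Rightarrow> phase_point \<Rightarrow> real" where
  "phase_dist N = (\<lambda>(q, p) (q', p'). Max ((\<lambda>L. dist (q L, p L) (q' L, p' L)) ` {1..N}))"

end

theory Submission
  imports Defs
begin

text \<open>
  Permuting the coordinate planes by \<open>\<sigma>\<close> maps \<open>\<Psi>\<^sub>f\<close> onto \<open>\<Psi>\<^sub>g\<close> and preserves the maximum metric, so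
  it suffices that isometries preserve barcodes. As the permutation is a bijection of the whole
  ambient type, it acts on chains by precomposition, which induces isomorphisms between the images
  of \<open>H\<^sub>n(K) \<rightarrow> H\<^sub>n(L)\<close> whose dimensions determine the barcode. That these images are vector spaces
  has to be shown explicitly, because \<^const>\<open>vectorspace.dim\<close> is unspecified otherwise. This follows
  from their description as quotients of subspaces of a space of functions.
\<close>

section \<open>Quotients of spaces of functions\<close>

text \<open>Only the carrier depends on \<open>Z\<close>; the operations are pointwise for every
  \<open>Z\<close>, which later allows the carrier to be exchanged.\<close>

definition function_space :: "('x \<Rightarrow> 'k) set \<Rightarrow> ('k::field, 'x \<Rightarrow> 'k) module" where
  "function_space Z = \<lparr>carrier = Z, mult = undefined, one = undefined,
     zero = (\<lambda>_. 0), add = (\<lambda>c c' x. c x + c' x), smult = (\<lambda>a c x. a * c x)\<rparr>"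

definition function_subspace :: "('x \<Rightarrow> 'k::field) set \<Rightarrow> bool" where
  "function_subspace Z \<longleftrightarrow> (\<lambda>_. 0) \<in> Z \<and> (\<forall>c\<in>Z. \<forall>c'\<in>Z. (\<lambda>x. c x + c' x) \<in> Z) \<and>
     (\<forall>a. \<forall>c\<in>Z. (\<lambda>x. a * c x) \<in> Z)"

text \<open>The coset of \<open>z\<close> modulo \<open>B\<close>, written without an ambient
  module; \<open>z\<close> may be any function.\<close>

definition translate :: "('x \<Rightarrow> 'k::field) set \<Rightarrow> ('x \<Rightarrow> 'k) \<Rightarrow> ('x \<Rightarrow> 'k) set" where
  "translate B z = (\<lambda>b x. b x + z x) ` B"

lemma function_subspace_zero: "function_subspace Z \<Longrightarrow> (\<lambda>_. 0) \<in> Z"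
  by (simp add: function_subspace_def)

lemma function_subspace_add:
  "function_subspace Z \<Longrightarrow> c \<in> Z \<Longrightarrow> c' \<in> Z \<Longrightarrow> (\<lambda>x. c x + c' x) \<in> Z"
  by (simp add: function_subspace_def)

lemma function_subspace_smult:
  "function_subspace Z \<Longrightarrow> c \<in> Z \<Longrightarrow> (\<lambda>x. a * c x) \<in> Z"
  by (simp add: function_subspace_def)

lemma function_subspace_diff:
  "function_subspace Z \<Longrightarrow> c \<in> Z \<Longrightarrow> c' \<in> Z \<Longrightarrow> (\<lambda>x. c x - c' x) \<in> Z"
  using function_subspace_add[of Z c "\<lambda>x. - 1 * c' x"] function_subspace_smult[of Z c' "- 1"]
  by simp

section \<open>Arithmetic of cosets\<close>

lemma translate_eqI:
  assumes "function_subspace B" "(\<lambda>x. y x - z x) \<in> B"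
  shows "translate B y = translate B z"
proof (intro equalityI subsetI)
  fix c assume "c \<in> translate B y"
  then obtain b where b: "b \<in> B" "c = (\<lambda>x. b x + y x)"
    by (auto simp: translate_def)
  have "(\<lambda>x. b x + (y x - z x)) \<in> B"
    using function_subspace_add[OF assms(1) b(1) assms(2)] .
  then show "c \<in> translate B z"
    by (force simp: translate_def b(2))
next
  fix c assume "c \<in> translate B z"
  then obtain b where b: "b \<in> B" "c = (\<lambda>x. b x + z x)"
    by (auto simp: translate_def)
  have "(\<lambda>x. b x - (y x - z x)) \<in> B"
    using function_subspace_diff[OF assms(1) b(1) assms(2)] .
  then show "c \<in> translate B y"
    by (force simp: translate_def b(2))
qed

lemma translate_zero [simp]: "translate B (\<lambda>_. 0) = B"
  by (simp add: translate_def)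

lemma self_in_translate: "function_subspace B \<Longrightarrow> z \<in> translate B z"
  using function_subspace_zero[of B] by (force simp: translate_def)

lemma r_coset_function_space [simp]: "B +>\<^bsub>function_space Z\<^esub> z = translate B z"
  by (auto simp: a_r_coset_def' function_space_def translate_def)

lemma set_add_translate:
  assumes "function_subspace B"
  shows "translate B y <+>\<^bsub>function_space Z\<^esub> translate B z = translate B (\<lambda>x. y x + z x)"
proof (intro equalityI subsetI)
  fix c assume "c \<in> translate B y <+>\<^bsub>function_space Z\<^esub> translate B z"
  then obtain b b' where b: "b \<in> B" "b' \<in> B" "c = (\<lambda>x. b x + y x + (b' x + z x))"
    by (auto simp: set_add_def' function_space_def translate_def)
  have "(\<lambda>x. b x + b' x) \<in> B"
    using function_subspace_add[OF assms b(1,2)] .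
  then show "c \<in> translate B (\<lambda>x. y x + z x)"
    by (force simp: translate_def b(3))
next
  fix c assume "c \<in> translate B (\<lambda>x. y x + z x)"
  then obtain b where b: "b \<in> B" "c = (\<lambda>x. b x + (y x + z x))"
    by (auto simp: translate_def)
  \<comment> \<open>The first summand absorbs all of \<open>b\<close>, and \<open>z\<close> lies in
    its own coset.\<close>
  then have "c = (\<lambda>x. (b x + y x) + z x)" "(\<lambda>x. b x + y x) \<in> translate B y"
    by (auto simp: translate_def)
  then show "c \<in> translate B y <+>\<^bsub>function_space Z\<^esub> translate B z"
    using self_in_translate[OF assms, of z]
    by (force simp: set_add_def' function_space_def)
qed

text \<open>Scalar multiplication in \<open>quotient_space\<close> is a union over representatives.
  Two of them differ by an element of \<open>B\<close>, hence so do their multiples, and all cosets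
  in the union coincide.\<close>

lemma UN_translate_smult:
  assumes "function_subspace B"
  shows "(\<Union>c\<in>translate B z. translate B (\<lambda>x. a * c x)) = translate B (\<lambda>x. a * z x)"
proof -
  have "translate B (\<lambda>x. a * c x) = translate B (\<lambda>x. a * z x)" if c: "c \<in> translate B z" for c
  proof -
    obtain b where b: "b \<in> B" "c = (\<lambda>x. b x + z x)"
      using c by (auto simp: translate_def)
    show ?thesis
      using function_subspace_smult[OF assms b(1), of a]
      by (intro translate_eqI[OF assms]) (simp add: b(2) algebra_simps)
  qed
  then show ?thesis
    using self_in_translate[OF assms] by blast
qed

text \<open>Evaluates the union in \<open>homology_inclusion\<close> at one class: representatives
  modulo \<open>B\<close> differ by elements of \<open>B'\<close>, so they define a single coset of
  \<open>B'\<close>.\<close>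

lemma UN_translate_mono:
  assumes "function_subspace B" "function_subspace B'" "B \<subseteq> B'"
  shows "(\<Union>c\<in>translate B z. translate B' c) = translate B' z"
proof -
  have "translate B' c = translate B' z" if "c \<in> translate B z" for c
    using that assms by (intro translate_eqI) (auto simp: translate_def)
  then show ?thesis
    using self_in_translate[OF assms(1)] by blast
qed

lemma carrier_quotient_space:
  "carrier (quotient_space (function_space Z) B) = translate B ` Z"
  by (auto simp: quotient_space_def A_RCOSETS_def RCOSETS_def r_coset_def function_space_def
      translate_def)

text \<open>Neither addition nor scalar multiplication of cosets refers to the carrier of the
  ambient space. Hence the image of an induced map is itself a quotient.\<close>

lemma quotient_space_update_carrier:
  "(quotient_space (function_space Z) B)\<lparr>carrier := translate B ` Z'\<rparr> =
    quotient_space (function_space Z') B"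
proof -
  have "set_add (function_space Z) = set_add (function_space Z')"
    by (intro ext) (simp add: set_add_def' function_space_def)
  moreover have "module.smult (function_space Z) = module.smult (function_space Z')"
    by (simp add: function_space_def)
  ultimately show ?thesis
    using carrier_quotient_space[of Z' B] by (simp add: quotient_space_def)
qed

lemma zero_quotient_space: "\<zero>\<^bsub>quotient_space V B\<^esub> = B"
  by (simp add: quotient_space_def)

lemma add_quotient_space:
  "function_subspace B \<Longrightarrow> translate B y \<oplus>\<^bsub>quotient_space (function_space Z) B\<^esub> translate B z =
    translate B (\<lambda>x. y x + z x)"
  by (simp add: quotient_space_def set_add_translate)

lemma smult_quotient_space:
  "function_subspace B \<Longrightarrow> a \<odot>\<^bsub>quotient_space (function_space Z) B\<^esub> translate B z =
    translate B (\<lambda>x. a * z x)"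
  using UN_translate_smult[of B a z] by (simp add: quotient_space_def) (simp add: function_space_def)

lemmas quotient_space_ops =
  carrier_quotient_space zero_quotient_space add_quotient_space smult_quotient_space

lemma field_is_cring: "field R \<Longrightarrow> cring R"
  by (simp add: field_def domain_def)

text \<open>The carrier is the image of \<open>Z\<close> in the quotient of all functions by
  \<open>B\<close>, that is \<open>(Z + B) / B\<close>; the axioms reduce to the closure properties
  of \<open>Z\<close> and \<open>B\<close>.\<close>

lemma vectorspace_quotient_space:
  assumes Z: "function_subspace Z" and B: "function_subspace (B :: ('x \<Rightarrow> 'k::field) set)"
  shows "vectorspace class_ring (quotient_space (function_space Z) B)"
proof -
  let ?Q = "quotient_space (function_space Z) B"
  have add: "translate B (\<lambda>x. y x + z x) \<in> translate B ` Z" if "y \<in> Z" "z \<in> Z" for y z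
    using function_subspace_add[OF Z that] by blast
  have smult: "translate B (\<lambda>x. a * z x) \<in> translate B ` Z" if "z \<in> Z" for a z
    using function_subspace_smult[OF Z that] by blast
  \<comment> \<open>Exhibits the zero of the quotient as the coset of the zero function, which lies
    in \<open>Z\<close>.\<close>
  have B0: "B = translate B (\<lambda>_. 0)"
    by simp
  have "abelian_group ?Q"
  proof (rule abelian_groupI)
    fix A assume "A \<in> carrier ?Q"
    then obtain z where z: "z \<in> Z" "A = translate B z"
      by (auto simp: quotient_space_ops)
    show "\<zero>\<^bsub>?Q\<^esub> \<oplus>\<^bsub>?Q\<^esub> A = A"
      using add_quotient_space[OF B, where y = "\<lambda>_. 0"] z(2) by (simp add: zero_quotient_space)
    show "\<exists>A'\<in>carrier ?Q. A' \<oplus>\<^bsub>?Q\<^esub> A = \<zero>\<^bsub>?Q\<^esub>"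
    proof
      show "translate B (\<lambda>x. - 1 * z x) \<in> carrier ?Q"
        using smult[OF z(1)] by (simp only: quotient_space_ops)
      show "translate B (\<lambda>x. - 1 * z x) \<oplus>\<^bsub>?Q\<^esub> A = \<zero>\<^bsub>?Q\<^esub>"
        using B z(2) by (simp add: quotient_space_ops)
    qed
  next
    show "\<zero>\<^bsub>?Q\<^esub> \<in> carrier ?Q"
      unfolding quotient_space_ops by (subst B0) (intro imageI function_subspace_zero[OF Z])
  qed (use B add in \<open>auto simp: quotient_space_ops algebra_simps\<close>)
  then have "Module.module class_ring ?Q"
    by (intro moduleI)
      (use B smult in \<open>auto simp: quotient_space_ops algebra_simps intro: field_is_cring[OF class_field]\<close>)
  then show ?thesis
    using class_field by (intro vectorspace.intro)
qed

text \<open>If neither space is finite-dimensional, then both dimensions are the same junk value.\<close>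

lemma dim_eq_of_linear_bijections:
  assumes "linear_map K V W f" "inj_on f (carrier V)" "f ` carrier V = carrier W"
    and "linear_map K W V g" "g ` carrier W = carrier V"
  shows "vectorspace.dim K V = vectorspace.dim K W"
proof -
  interpret f: linear_map K V W f by fact
  interpret g: linear_map K W V g by fact
  \<comment> \<open>Finite dimension passes along surjective linear maps: \<open>f\<close> gives one
    implication and \<open>g\<close> the other.\<close>
  have iff: "f.V.fin_dim \<longleftrightarrow> f.W.fin_dim"
    using f.surj_fin_dim g.surj_fin_dim assms by blast
  show ?thesis
  proof (cases "f.V.fin_dim")
    case True
    then show ?thesis
      using f.dim_eq assms by blast
  next
    case False
    then have "\<not> f.W.fin_dim"
      using iff by simp
    with False show ?thesis
      unfolding f.V.dim_def f.W.dim_def f.V.fin_dim_def f.W.fin_dim_def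
      by (intro arg_cong[where f = Least] ext) blast
  qed
qed

section \<open>Precomposition as a map between quotients\<close>

lemma image_comp_translate:
  "(\<lambda>c. c \<circ> k) ` translate B z = translate ((\<lambda>c. c \<circ> k) ` B) (z \<circ> k)"
  unfolding translate_def image_image by (simp add: comp_def)

lemma function_subspace_comp:
  assumes "function_subspace Z"
  shows "function_subspace ((\<lambda>c. c \<circ> k) ` Z)"
  unfolding function_subspace_def
proof (intro conjI ballI allI)
  show "(\<lambda>_. 0) \<in> (\<lambda>c. c \<circ> k) ` Z"
    using function_subspace_zero[OF assms] by (force simp: comp_def)
next
  fix c c' assume "c \<in> (\<lambda>c. c \<circ> k) ` Z" "c' \<in> (\<lambda>c. c \<circ> k) ` Z"
  then obtain z z' where "z \<in> Z" "c = z \<circ> k" "z' \<in> Z" "c' = z' \<circ> k"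
    by blast
  then show "(\<lambda>x. c x + c' x) \<in> (\<lambda>c. c \<circ> k) ` Z"
    using function_subspace_add[OF assms, of z z'] by (force simp: comp_def)
next
  fix a c assume "c \<in> (\<lambda>c. c \<circ> k) ` Z"
  then obtain z where "z \<in> Z" "c = z \<circ> k"
    by blast
  then show "(\<lambda>x. a * c x) \<in> (\<lambda>c. c \<circ> k) ` Z"
    using function_subspace_smult[OF assms, of z a] by (force simp: comp_def)
qed

text \<open>Precomposition is linear on functions and sends each coset of \<open>B\<close> to a
  coset of the image of \<open>B\<close>.\<close>

lemma linear_map_quotient_comp:
  fixes Z B :: "('x \<Rightarrow> 'k::field) set" and k :: "'y \<Rightarrow> 'x"
  assumes "function_subspace Z" "function_subspace B"
  defines "T \<equiv> \<lambda>c. c \<circ> k"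
  shows "linear_map class_ring (quotient_space (function_space Z) B)
    (quotient_space (function_space (T ` Z)) (T ` B)) ((`) T)"
proof -
  have sub: "function_subspace (T ` Z)" "function_subspace (T ` B)"
    unfolding T_def by (simp_all add: assms function_subspace_comp)
  have im: "T ` translate B z = translate (T ` B) (T z)" for z
    by (simp add: T_def image_comp_translate)
  have T_add: "T (\<lambda>x. y x + z x) = (\<lambda>x. T y x + T z x)"
    and T_smult: "T (\<lambda>x. a * z x) = (\<lambda>x. a * T z x)" for y z a
    by (simp_all add: T_def comp_def)
  let ?V = "quotient_space (function_space Z) B"
  let ?W = "quotient_space (function_space (T ` Z)) (T ` B)"
  have V: "vectorspace class_ring ?V" and W: "vectorspace class_ring ?W"
    by (intro vectorspace_quotient_space assms sub)+
  have "(`) T \<in> module_hom class_ring ?V ?W"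
    unfolding module_hom_def mem_Collect_eq
  proof (intro conjI ballI allI impI)
    show "(`) T \<in> carrier ?V \<rightarrow> carrier ?W"
      by (auto simp: quotient_space_ops im)
  qed (use assms(1,2) sub in \<open>clarsimp simp: quotient_space_ops im T_add T_smult\<close>)+
  then show ?thesis
    using V W by (intro linear_map.intro mod_hom.intro mod_hom_axioms.intro)
      (auto simp: vectorspace_def)
qed

text \<open>Precomposition with the inverse of \<open>k\<close> undoes \<open>T\<close>. This yields
  both the injectivity of \<open>T\<close> and the opposite linear surjection that
  \<open>dim_eq_of_linear_bijections\<close> asks for.\<close>

lemma dim_quotient_comp:
  fixes Z B :: "('x \<Rightarrow> 'k::field) set" and k :: "'y \<Rightarrow> 'x"
  assumes sub: "function_subspace Z" "function_subspace B" and k: "bij k"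
  defines "T \<equiv> \<lambda>c. c \<circ> k"
  shows "vectorspace.dim class_ring (quotient_space (function_space (T ` Z)) (T ` B)) =
    vectorspace.dim class_ring (quotient_space (function_space Z) B)"
proof -
  define S :: "('y \<Rightarrow> 'k) \<Rightarrow> 'x \<Rightarrow> 'k" where "S = (\<lambda>c. c \<circ> inv_into UNIV k)"
  have ST: "S (T c) = c" and TS: "T (S d) = d" for c d
    using k by (simp_all add: S_def T_def comp_assoc bij_is_surj bij_is_inj surj_iff[THEN iffD1])
  have ST': "S ` T ` A = A" for A
    by (simp add: image_image ST)
  have "inj T"
    using ST by (metis injI)
  let ?V = "quotient_space (function_space Z) B"
  let ?W = "quotient_space (function_space (T ` Z)) (T ` B)"
  have T: "linear_map class_ring ?V ?W ((`) T)"
    unfolding T_def by (intro linear_map_quotient_comp sub)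
  \<comment> \<open>The previous lemma for the inverse of \<open>k\<close>; \<open>ST'\<close> then
    turns its target back into \<open>?V\<close>.\<close>
  have "linear_map class_ring ?W
      (quotient_space (function_space (S ` T ` Z)) (S ` T ` B)) ((`) S)"
    unfolding S_def by (intro linear_map_quotient_comp) (simp_all add: T_def sub function_subspace_comp)
  then have S: "linear_map class_ring ?W ?V ((`) S)"
    by (simp only: ST')
  have surj: "(`) T ` carrier ?V = carrier ?W"
    unfolding carrier_quotient_space image_image
    by (simp add: T_def image_comp_translate)
  then have "(`) S ` carrier ?W = carrier ?V"
    by (simp add: image_image ST flip: surj)
  then show ?thesis
    using dim_eq_of_linear_bijections[OF T _ surj S] \<open>inj T\<close>
    by (simp add: inj_on_def inj_image_eq_iff)
qed

section \<open>Homology of an isomorphic complex\<close>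

text \<open>Makes homology an instance of the quotients treated above.\<close>

lemma cycle_space_eq:
  "cycle_space K n = function_space {c \<in> oriented_chains K n. boundary n c = (\<lambda>_. 0)}"
  by (simp add: cycle_space_def chain_space_def function_space_def)

section \<open>Chains, cycles and boundaries as subspaces\<close>

lemma oriented_chains_finite: "c \<in> oriented_chains K n \<Longrightarrow> finite {xs. c xs \<noteq> 0}"
  by (simp add: oriented_chains_def)

lemma finite_Cons_support:
  fixes c :: "'a list \<Rightarrow> 'k::zero"
  assumes "finite {xs. c xs \<noteq> 0}"
  shows "finite {v. c (v # ys) \<noteq> 0}"
proof -
  have "finite ((\<lambda>v. v # ys) -` {xs. c xs \<noteq> 0})"
    using assms by (intro finite_vimageI) (auto simp: inj_def)
  then show ?thesis
    by (simp add: vimage_def)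
qed

text \<open>The sum in \<open>boundary\<close> runs over the support of the individual chain. A
  common larger index set makes different chains comparable, as in
  \<open>boundary_add\<close>.\<close>

lemma boundary_eq_sum:
  assumes "finite A" "{v. c (v # ys) \<noteq> 0} \<subseteq> A"
  shows "boundary n c ys = (if n = 0 then 0 else \<Sum>v\<in>A. c (v # ys))"
  using assms by (auto simp: boundary_def intro!: sum.mono_neutral_left)

lemma function_subspace_oriented_chains:
  "function_subspace (oriented_chains K n :: ('a list \<Rightarrow> 'k::field) set)"
  unfolding function_subspace_def
proof (intro conjI ballI allI)
  show "(\<lambda>_. 0) \<in> oriented_chains K n"
    by (simp add: oriented_chains_def)
next
  fix c c' :: "'a list \<Rightarrow> 'k" assume c: "c \<in> oriented_chains K n" "c' \<in> oriented_chains K n"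
  have "finite ({xs. c xs \<noteq> 0} \<union> {xs. c' xs \<noteq> 0})"
    using c by (simp add: oriented_chains_finite)
  then have "finite {xs. c xs + c' xs \<noteq> 0}"
    by (rule rev_finite_subset) auto
  then show "(\<lambda>xs. c xs + c' xs) \<in> oriented_chains K n"
    using c unfolding oriented_chains_def by (simp add: distrib_left) (metis add.right_neutral)
next
  fix a and c :: "'a list \<Rightarrow> 'k" assume c: "c \<in> oriented_chains K n"
  then have "finite {xs. a * c xs \<noteq> 0}"
    by (intro rev_finite_subset[OF oriented_chains_finite[OF c]]) auto
  then show "(\<lambda>xs. a * c xs) \<in> oriented_chains K n"
    using c unfolding oriented_chains_def by simp
qed

lemma boundary_add:
  fixes c c' :: "'a list \<Rightarrow> 'k::field"
  assumes "c \<in> oriented_chains K m" "c' \<in> oriented_chains K m"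
  shows "boundary n (\<lambda>xs. c xs + c' xs) = (\<lambda>ys. boundary n c ys + boundary n c' ys)"
proof
  fix ys
  let ?A = "{v. c (v # ys) \<noteq> 0} \<union> {v. c' (v # ys) \<noteq> 0}"
  have fin: "finite ?A"
    using assms by (simp add: finite_Cons_support oriented_chains_finite)
  have "{v. c (v # ys) + c' (v # ys) \<noteq> 0} \<subseteq> ?A"
    by auto
  then show "boundary n (\<lambda>xs. c xs + c' xs) ys = boundary n c ys + boundary n c' ys"
    using boundary_eq_sum[OF fin, of c ys n] boundary_eq_sum[OF fin, of c' ys n]
      boundary_eq_sum[OF fin, of "\<lambda>xs. c xs + c' xs" ys n]
    by (simp add: sum.distrib)
qed

text \<open>For \<open>a \<noteq> 0\<close> both sums run over the same vertices, finitely many or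
  not; for \<open>a = 0\<close> both sides vanish.\<close>

lemma boundary_smult: "boundary n (\<lambda>xs. a * c xs) = (\<lambda>ys. a * boundary n c ys)"
  by (cases "a = 0") (auto simp: boundary_def sum_distrib_left)

lemma boundary_zero: "boundary n (\<lambda>_. 0) = (\<lambda>_. 0)"
  by (simp add: boundary_def)

lemma function_subspace_cycles:
  "function_subspace {c \<in> oriented_chains K n. boundary n c = (\<lambda>_. 0)}"
  using function_subspace_oriented_chains[of K n]
  by (auto simp: function_subspace_def boundary_add boundary_smult boundary_zero)

lemma function_subspace_boundaries:
  "function_subspace (boundaries K n :: ('a list \<Rightarrow> 'k::field) set)"
  unfolding function_subspace_def boundaries_def
proof (intro conjI ballI allI)
  note sub = function_subspace_oriented_chains[of K "Suc n"]
  show "(\<lambda>_. 0) \<in> boundary (Suc n) ` oriented_chains K (Suc n)"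
    by (rule image_eqI[OF _ function_subspace_zero[OF sub]]) (simp add: boundary_zero)
  fix c c' :: "'a list \<Rightarrow> 'k"
  assume "c \<in> boundary (Suc n) ` oriented_chains K (Suc n)"
  then obtain b where b: "b \<in> oriented_chains K (Suc n)" "c = boundary (Suc n) b"
    by blast
  show "(\<lambda>xs. a * c xs) \<in> boundary (Suc n) ` oriented_chains K (Suc n)" for a
    by (intro image_eqI[OF _ function_subspace_smult[OF sub b(1)]]) (simp add: b(2) boundary_smult)
  assume "c' \<in> boundary (Suc n) ` oriented_chains K (Suc n)"
  then obtain b' where b': "b' \<in> oriented_chains K (Suc n)" "c' = boundary (Suc n) b'"
    by blast
  show "(\<lambda>xs. c xs + c' xs) \<in> boundary (Suc n) ` oriented_chains K (Suc n)"
    by (rule image_eqI[OF _ function_subspace_add[OF sub b(1) b'(1)]])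
      (simp add: b(2) b'(2) boundary_add[OF b(1) b'(1)])
qed

lemma boundaries_mono: "K \<subseteq> L \<Longrightarrow> boundaries K n \<subseteq> boundaries L n"
  unfolding boundaries_def oriented_chains_def by (intro image_mono) blast

text \<open>The image of \<open>H\<^sub>n(K) \<rightarrow> H\<^sub>n(L)\<close> is the quotient of \<open>Z\<^sub>n(K)\<close> by \<open>B\<^sub>n(L)\<close>; here
  \<^const>\<open>quotient_space\<close> does not require the second space to be contained in the first one.\<close>

lemma image_homology_inclusion:
  assumes "K \<subseteq> L"
  shows "(homology L n)\<lparr>carrier := homology_inclusion L n ` carrier (homology K n)\<rparr> =
    (quotient_space (cycle_space K n) (boundaries L n) :: ('k::field, _) module)"
proof -
  let ?Z = "\<lambda>K. {c \<in> oriented_chains K n. boundary n c = (\<lambda>_. 0 :: 'k)}"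
  have "boundaries K n \<subseteq> (boundaries L n :: ('a list \<Rightarrow> 'k) set)"
    using assms by (rule boundaries_mono)
  \<comment> \<open>The class of a cycle \<open>z\<close> goes to the coset of \<open>z\<close>
    modulo \<open>boundaries L n\<close>.\<close>
  then have "homology_inclusion L n ` carrier (homology K n) = translate (boundaries L n) ` ?Z K"
    by (simp add: homology_def cycle_space_eq carrier_quotient_space homology_inclusion_def
        image_image UN_translate_mono function_subspace_boundaries)
  then show ?thesis
    by (simp add: homology_def cycle_space_eq quotient_space_update_carrier)
qed

text \<open>As \<open>map h\<close> undoes \<open>map k\<close>, the new support lies in the image
  of the old one under \<open>map h\<close>, and vertex sets are images of simplices under
  \<open>h\<close>. Signs survive because \<open>permute_list\<close> commutes with
  \<open>map\<close>.\<close>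

lemma oriented_chains_comp:
  assumes "c \<in> oriented_chains K n" "\<And>y. h (k y) = y"
  shows "c \<circ> map k \<in> oriented_chains ((`) h ` K) n"
proof -
  have hk: "map h (map k ys) = ys" for ys
    by (simp add: assms comp_def)
  have supp: "{ys. c (map k ys) \<noteq> 0} \<subseteq> map h ` {xs. c xs \<noteq> 0}"
  proof
    fix ys assume "ys \<in> {ys. c (map k ys) \<noteq> 0}"
    then show "ys \<in> map h ` {xs. c xs \<noteq> 0}"
      using hk[of ys] by (metis imageI mem_Collect_eq)
  qed
  have "length ys = Suc n \<and> distinct ys \<and> set ys \<in> (`) h ` K" if "c (map k ys) \<noteq> 0" for ys
  proof -
    have *: "length (map k ys) = Suc n" "distinct (map k ys)" "set (map k ys) \<in> K"
      using that assms(1) unfolding oriented_chains_def by blast+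
    have "set ys = h ` set (map k ys)"
      using hk[of ys] by (metis set_map)
    then show ?thesis
      using * by (auto simp: distinct_map)
  qed
  moreover have "c (map k (permute_list \<pi> ys)) = of_int (sign \<pi>) * c (map k ys)"
    if "\<pi> permutes {..<length ys}" for ys \<pi>
    using that assms(1) by (simp add: oriented_chains_def flip: permute_list_map)
  ultimately show ?thesis
    using finite_subset[OF supp] oriented_chains_finite[OF assms(1)]
    by (simp add: oriented_chains_def)
qed

text \<open>Reindexing the added vertex by \<open>k\<close> identifies the two sums. This vertex
  ranges over the whole type, hence \<open>bij k\<close>.\<close>

lemma boundary_comp:
  assumes "bij k"
  shows "boundary n (c \<circ> map k) = boundary n c \<circ> map k"
proof
  fix ys
  have "(\<Sum>v | c (k v # map k ys) \<noteq> 0. c (k v # map k ys)) =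
      (\<Sum>v | c (v # map k ys) \<noteq> 0. c (v # map k ys))"
  proof (rule sum.reindex_bij_betw)
    show "bij_betw k {v. c (k v # map k ys) \<noteq> 0} {v. c (v # map k ys) \<noteq> 0}"
      using bij_betw_Collect[OF assms, of "\<lambda>v. c (v # map k ys) \<noteq> 0"] by simp
  qed
  then show "boundary n (c \<circ> map k) ys = (boundary n c \<circ> map k) ys"
    by (simp add: boundary_def)
qed

lemma bij_map:
  assumes "bij k"
  shows "bij (map k)"
proof (rule o_bij)
  show "map (inv_into UNIV k) \<circ> map k = id" "map k \<circ> map (inv_into UNIV k) = id"
    using assms by (simp_all add: bij_is_inj bij_is_surj surj_iff[THEN iffD1])
qed

section \<open>Transport of homology along a bijection of the vertex types\<close>

context
  fixes h :: "'a \<Rightarrow> 'b" and k :: "'b \<Rightarrow> 'a"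
  assumes kh: "k (h x) = x" and hk: "h (k y) = y"
begin

text \<open>Simplices are pushed along \<open>h\<close> and chains pulled back along
  \<open>k\<close>. The two inclusions are \<open>oriented_chains_comp\<close> with the roles of
  \<open>h\<close> and \<open>k\<close> exchanged.\<close>

lemma image_oriented_chains:
  "oriented_chains ((`) h ` K) n = (\<lambda>c. c \<circ> map k) ` oriented_chains K n"
proof (intro equalityI subsetI)
  fix c assume c: "c \<in> oriented_chains ((`) h ` K) n"
  have "(`) k ` (`) h ` K = K"
    by (simp add: image_image kh)
  then have "c \<circ> map h \<in> oriented_chains K n"
    using oriented_chains_comp[OF c, of k h, OF kh] by metis
  moreover have "c = (c \<circ> map h) \<circ> map k"
    by (auto simp: comp_def hk)
  ultimately show "c \<in> (\<lambda>c. c \<circ> map k) ` oriented_chains K n"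
    by blast
next
  fix c assume "c \<in> (\<lambda>c. c \<circ> map k) ` oriented_chains K n"
  then obtain b where "b \<in> oriented_chains K n" "c = b \<circ> map k"
    by blast
  then show "c \<in> oriented_chains ((`) h ` K) n"
    using oriented_chains_comp[where h = h and k = k, OF _ hk] by metis
qed

lemma bij_inverse: "bij k"
  by (metis bijI' hk kh)

lemma image_boundaries:
  "boundaries ((`) h ` K) n = (\<lambda>c. c \<circ> map k) ` boundaries K n"
  by (simp add: boundaries_def image_oriented_chains image_image boundary_comp bij_inverse)

text \<open>The boundary commutes with precomposition, and precomposition with the surjection
  \<open>map k\<close> detects zero.\<close>

lemma image_cycles:
  "{c \<in> oriented_chains ((`) h ` K) n. boundary n c = (\<lambda>_. 0 :: 'k::field)} =
    (\<lambda>c. c \<circ> map k) ` {c \<in> oriented_chains K n. boundary n c = (\<lambda>_. 0)}"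
proof -
  have "boundary n (c \<circ> map k) = (\<lambda>_. 0) \<longleftrightarrow> boundary n c = (\<lambda>_. 0 :: 'k)" for c
    using bij_is_surj[OF bij_map[OF bij_inverse]]
    by (simp add: boundary_comp bij_inverse fun_eq_iff) (metis surjD)
  then show ?thesis
    unfolding image_oriented_chains by auto
qed

text \<open>Both images are quotients of cycles of the smaller complex by boundaries of the larger
  one, and \<open>map k\<close> carries one pair of spaces to the other.\<close>

lemma dim_image_homology_inclusion:
  assumes "K \<subseteq> L"
  shows "vectorspace.dim class_ring ((homology ((`) h ` L) n)
      \<lparr>carrier := homology_inclusion ((`) h ` L) n ` carrier (homology ((`) h ` K) n)\<rparr>
      :: ('k::field, _) module) =
    vectorspace.dim class_ring ((homology L n)
      \<lparr>carrier := homology_inclusion L n ` carrier (homology K n)\<rparr> :: ('k, _) module)"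
  using assms dim_quotient_comp[OF function_subspace_cycles[of K n]
      function_subspace_boundaries[of L n] bij_map[OF bij_inverse]]
  by (simp add: image_homology_inclusion image_mono cycle_space_eq image_cycles image_boundaries)

end


section \<open>Isometry invariance of barcodes\<close>

lemma vietoris_rips_mono: "s \<le> t \<Longrightarrow> vietoris_rips X d s \<subseteq> vietoris_rips X d t"
  by (auto simp: vietoris_rips_def)

text \<open>Subsets of the image of \<open>X\<close> are images of subsets \<open>S\<close> of
  \<open>X\<close> with the same set of pairwise distances; injectivity preserves finiteness in both
  directions.\<close>

lemma vietoris_rips_image:
  assumes "inj h" and d: "\<And>x y. x \<in> X \<Longrightarrow> y \<in> X \<Longrightarrow> d' (h x) (h y) = d x y"
  shows "vietoris_rips (h ` X) d' \<epsilon> = (`) h ` vietoris_rips X d \<epsilon>"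
proof -
  have "(\<lambda>(x, y). d' x y) ` (h ` S \<times> h ` S) = (\<lambda>(x, y). d x y) ` (S \<times> S)" if "S \<subseteq> X" for S
  proof -
    have "(\<lambda>(x, y). d' x y) ` (h ` S \<times> h ` S) = (\<lambda>(x, y). d' (h x) (h y)) ` (S \<times> S)"
      by force
    also have "\<dots> = (\<lambda>(x, y). d x y) ` (S \<times> S)"
      using that d by (intro image_cong) auto
    finally show ?thesis .
  qed
  then have iff: "h ` S \<in> vietoris_rips (h ` X) d' \<epsilon> \<longleftrightarrow> S \<in> vietoris_rips X d \<epsilon>" if "S \<subseteq> X" for S
    using that assms(1) by (auto simp: vietoris_rips_def finite_image_iff inj_on_subset)
  show ?thesis
  proof (intro equalityI subsetI)
    fix T assume T: "T \<in> vietoris_rips (h ` X) d' \<epsilon>"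
    then have "T \<subseteq> h ` X"
      by (simp add: vietoris_rips_def)
    then obtain S where "S \<subseteq> X" "T = h ` S"
      by (auto simp: subset_image_iff)
    with T iff show "T \<in> (`) h ` vietoris_rips X d \<epsilon>"
      by blast
  next
    fix T assume "T \<in> (`) h ` vietoris_rips X d \<epsilon>"
    then obtain S where "S \<in> vietoris_rips X d \<epsilon>" "T = h ` S"
      by blast
    moreover from this have "S \<subseteq> X"
      by (simp add: vietoris_rips_def)
    ultimately show "T \<in> vietoris_rips (h ` X) d' \<epsilon>"
      using iff by blast
  qed
qed

text \<open>The rectangles in the infimum satisfy \<open>a < b < c < d\<close>, so their measures
  involve ranks at strictly increasing pairs only.\<close>

lemma barcode_cong:
  assumes "\<And>s t. s < t \<Longrightarrow> persistent_rank V \<phi> s t = persistent_rank V' \<phi>' s t"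
  shows "barcode V \<phi> = barcode V' \<phi>'"
proof -
  have measure_eq: "persistence_measure V \<phi> a b c d = persistence_measure V' \<phi>' a b c d"
    if "a < b" "b < c" "c < d" for a b c d
  proof -
    have "a < c" "b < d" "a < d"
      using that by auto
    with that show ?thesis
      by (simp add: persistence_measure_def assms)
  qed
  have "{nat (persistence_measure V \<phi> a b c d) | a b c d.
      a < b \<and> b < c \<and> c < d \<and> (p, q) \<in> interior ({a..b} \<times> {c..d})} =
    {nat (persistence_measure V' \<phi>' a b c d) | a b c d.
      a < b \<and> b < c \<and> c < d \<and> (p, q) \<in> interior ({a..b} \<times> {c..d})}" for p q
    by (intro Collect_cong ex_cong1) (auto simp: measure_eq)
  then show ?thesis
    by (simp add: barcode_def fun_eq_iff)
qed

lemma rips_barcode_isometry: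
  assumes "bij h" and d: "\<And>x y. x \<in> X \<Longrightarrow> y \<in> X \<Longrightarrow> d' (h x) (h y) = d x y"
  shows "rips_barcode TYPE('k::field) n (h ` X) d' = rips_barcode TYPE('k) n X d"
proof -
  have rips: "vietoris_rips (h ` X) d' \<epsilon> = (`) h ` vietoris_rips X d \<epsilon>" for \<epsilon>
    using assms by (intro vietoris_rips_image) (auto simp: bij_is_inj)
  have inv: "inv_into UNIV h (h x) = x" "h (inv_into UNIV h y) = y" for x y
    using assms(1) by (simp_all add: bij_is_inj bij_is_surj surj_f_inv_f)
  show ?thesis
    unfolding rips_barcode_def rips
  proof (rule barcode_cong)
    fix s t :: ereal assume "s < t"
    \<comment> \<open>If \<open>s = -\<infinity>\<close> or \<open>t = \<infinity>\<close>, both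
      ranks are 0 by definition. Otherwise \<open>s < t\<close> makes both parameters real, and the
      complexes are nested.\<close>
    then have "s \<noteq> - \<infinity> \<Longrightarrow> t \<noteq> \<infinity> \<Longrightarrow> real_of_ereal s \<le> real_of_ereal t"
      by (cases s; cases t) auto
    then show "persistent_rank (\<lambda>\<epsilon>. homology ((`) h ` vietoris_rips X d \<epsilon>) n :: ('k, _) module)
          (\<lambda>s t. homology_inclusion ((`) h ` vietoris_rips X d t) n) s t =
        persistent_rank (\<lambda>\<epsilon>. homology (vietoris_rips X d \<epsilon>) n :: ('k, _) module)
          (\<lambda>s t. homology_inclusion (vietoris_rips X d t) n) s t"
      by (simp add: persistent_rank_def vietoris_rips_mono dim_image_homology_inclusion[OF inv])
  qed
qed


section \<open>Permuting the coordinate planes\<close>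

text \<open>Acts on all of \<open>phase_point\<close>, so that a permutation \<open>s\<close> gives
  a bijection of the type, as \<open>rips_barcode_isometry\<close> demands.\<close>

definition permute_planes :: "(nat \<Rightarrow> nat) \<Rightarrow> phase_point \<Rightarrow> phase_point" where
  "permute_planes s = (\<lambda>(q, p). (q \<circ> s, p \<circ> s))"

lemma permute_planes_inverse:
  assumes "s permutes A"
  shows "permute_planes s (permute_planes (inv_into UNIV s) x) = x"
    and "permute_planes (inv_into UNIV s) (permute_planes s x) = x"
  using permutes_inv_o[OF assms] by (auto simp: permute_planes_def comp_assoc split: prod.split)

text \<open>Coordinates outside \<open>{1..N}\<close> are \<open>undefined\<close> and stay so,
  because \<open>s\<close> fixes those indices.\<close>

lemma permute_planes_in_phase_space:
  assumes "s permutes {1..N}" "x \<in> phase_space N"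
  shows "permute_planes s x \<in> phase_space N"
proof -
  have "r \<circ> s \<in> {1..N} \<rightarrow>\<^sub>E UNIV" if "r \<in> {1..N} \<rightarrow>\<^sub>E UNIV" for r :: "nat \<Rightarrow> real"
    using that permutes_not_in[OF assms(1)] by (auto simp: PiE_iff extensional_def)
  then show ?thesis
    using assms(2) by (auto simp: phase_space_def permute_planes_def)
qed

lemma action_permute_planes: "action L (permute_planes s x) = action (s L) x"
  by (simp add: action_def permute_planes_def split: prod.split)

text \<open>The maximum is taken over the same set of distances, indexed in another order.\<close>

lemma phase_dist_permute_planes:
  assumes "s permutes {1..N}"
  shows "phase_dist N (permute_planes s x) (permute_planes s y) = phase_dist N x y"
proof -
  obtain q p q' p' where xy: "x = (q, p)" "y = (q', p')"
    by (metis surj_pair)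
  have "(\<lambda>L. dist (q (s L), p (s L)) (q' (s L), p' (s L))) ` {1..N} =
      (\<lambda>L. dist (q L, p L) (q' L, p' L)) ` s ` {1..N}"
    by (simp only: image_image)
  then show ?thesis
    using permutes_image[OF assms] by (simp add: phase_dist_def permute_planes_def xy)
qed

text \<open>Plane \<open>L\<close> of the image is plane \<open>s L\<close> of the argument, where
  the torus of \<open>f\<close> has the radius that \<open>g\<close> has at \<open>L\<close>. The
  inverse permutation supplies preimages.\<close>

lemma permute_planes_liouville_torus:
  assumes s: "s permutes {1..N}"
    and r: "\<And>L. L \<in> {1..N} \<Longrightarrow> fourier_radius g L = fourier_radius f (s L)"
  shows "permute_planes s ` liouville_torus N f = liouville_torus N g"
proof (intro equalityI subsetI)
  fix x assume "x \<in> permute_planes s ` liouville_torus N f"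
  then show "x \<in> liouville_torus N g"
    using permutes_in_image[OF s] permute_planes_in_phase_space[OF s] r
    by (auto simp: liouville_torus_def action_permute_planes)
next
  fix x assume x: "x \<in> liouville_torus N g"
  let ?t = "inv_into UNIV s"
  have t: "?t permutes {1..N}"
    using permutes_inv[OF s] .
  have "action L (permute_planes ?t x) = (fourier_radius f L)\<^sup>2 / 2" if "L \<in> {1..N}" for L
  proof -
    have "?t L \<in> {1..N}"
      using that permutes_in_image[OF t] by blast
    \<comment> \<open>At the index \<open>?t L\<close>, \<open>r\<close> equates the radius of
      \<open>g\<close> with that of \<open>f\<close> at \<open>s (?t L) = L\<close>.\<close>
    then show ?thesis
      using x r[of "?t L"] permutes_inverses(1)[OF s]
      by (simp add: liouville_torus_def action_permute_planes)
  qed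
  then have "permute_planes ?t x \<in> liouville_torus N f"
    using x permute_planes_in_phase_space[OF t] by (simp add: liouville_torus_def)
  then show "x \<in> permute_planes s ` liouville_torus N f"
    using permute_planes_inverse(1)[OF s] by (metis imageI)
qed

theorem proposition3p22:
  fixes N :: nat and \<sigma> :: "nat \<Rightarrow> nat" and f g :: "real \<Rightarrow> real" and n :: nat
  assumes "N \<ge> 1"
    and "bij_betw \<sigma> {1..N} {1..N}"
    and "time_series f" and "time_series g"
    and "\<And>L. L \<in> {1..N} \<Longrightarrow> fourier_coeff g (int L) = fourier_coeff f (int (\<sigma> L))"
  shows "rips_barcode TYPE('k::field) n (liouville_torus N f) (phase_dist N) =
         rips_barcode TYPE('k) n (liouville_torus N g) (phase_dist N)"
proof -
  \<comment> \<open>The values of \<open>\<sigma>\<close> outside \<open>{1..N}\<close> are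
    arbitrary; extending by the identity gives a permutation of all indices.\<close>
  define s where "s = (\<lambda>L. if L \<in> {1..N} then \<sigma> L else L)"
  have "bij_betw s {1..N} {1..N}"
    using assms(2) by (subst bij_betw_cong[of _ s \<sigma>]) (simp_all add: s_def)
  then have s: "s permutes {1..N}"
    by (rule bij_imp_permutes) (auto simp: s_def)
  have "permute_planes s ` liouville_torus N f = liouville_torus N g"
    \<comment> \<open>Equal Fourier coefficients have equal moduli, hence equal radii.\<close>
    using assms(5) by (intro permute_planes_liouville_torus[OF s]) (simp add: fourier_radius_def s_def)
  moreover have "bij (permute_planes s)"
    using permute_planes_inverse[OF s] by (metis bijI')
  ultimately show ?thesis
    using rips_barcode_isometry[of "permute_planes s" "liouville_torus N f" "phase_dist N" "phase_dist N",
        where 'k = 'k]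
    by (simp add: phase_dist_permute_planes[OF s])
qed

end
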